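(* Let $n\ge2$ and fix velocities $0<c_1<\cdots<c_n$. The collision patterns on $n$ particles are in bijection with the complete bracketings of $[n]=\{1,\dots,n\}$.
   Context: Particles: consider $n$ particles $1,\dots,n$ on the real line; particle $i$ has constant velocity $-c_i$ and location $-w_i$ at time $t=0$, where $-w_1\le-w_2\le\cdots\le-w_n$. When particles collide (are at the same location at the same time $t\ge0$), they merge: the faster particle, which is the one with the larger label $j$, absorbs the other particle $i<j$ and continues with its velocity $-c_j$, while $i$ disappears. The locations are assumed generic, so that never more than two surviving particles meet at the same place at the same time. The map $[n-1]\to[n]$ sending $i$ to the particle $j$ that absorbs it is the collision pattern of the locations $-w$. A collision pattern on $n$ particles is a map $[n-1]\to[n]$ that arises in this way from some generic weakly increasing locations $-w$ (for the fixed velocities $-c$). A bracket is a set $[i,j]=\{i,i+1,\dots,j\}$ with $1\le i<j\le n$. A bracketing of $[n]$ is a set of brackets containing $[1,n]$ any two of which are nested or disjoint. A complete bracketing is a bracketing with exactly $n-1$ brackets. *)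

theory Defs
  imports Complex_Main "HOL-Library.FuncSet"
begin

text \<open>Particles are the labels \<open>1, \<dots>, n\<close>; velocities and initial locations are functions
  \<open>c\<close> and \<open>w\<close> on \<open>nat\<close>, of which only the values on \<open>{1..n}\<close> matter.\<close>

definition pos :: "(nat \<Rightarrow> real) \<Rightarrow> (nat \<Rightarrow> real) \<Rightarrow> nat \<Rightarrow> real \<Rightarrow> real" where
  "pos c w i t = - w i - c i * t"

text \<open>\<open>present c w n i t\<close>: particle \<open>i\<close> has not been absorbed at any time before \<open>t\<close>. A particle
  absorbed exactly at time \<open>t\<close> is thus still present at \<open>t\<close> and takes part in the collision. As
  only larger labels absorb smaller ones, recursion on \<open>n - i\<close> is legitimate: \<open>i\<close> is gone as soon
  as it has met a particle with larger label that was itself present at the meeting. That \<open>i\<close> was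
  present there as well need not be demanded, see \<open>present_iff_not_absorbed\<close> below.\<close>

function present :: "(nat \<Rightarrow> real) \<Rightarrow> (nat \<Rightarrow> real) \<Rightarrow> nat \<Rightarrow> nat \<Rightarrow> real \<Rightarrow> bool" where
  "present c w n i t \<longleftrightarrow>
     \<not> (\<exists>j\<in>{i<..n}. \<exists>s\<in>{0..<t}. pos c w i s = pos c w j s \<and> present c w n j s)"
  by pat_completeness auto
termination
  by (relation "Wellfounded.measure (\<lambda>(c, w, n, i, t). n - i)") auto

declare present.simps [simp del]

definition absorbs :: "(nat \<Rightarrow> real) \<Rightarrow> (nat \<Rightarrow> real) \<Rightarrow> nat \<Rightarrow> nat \<Rightarrow> nat \<Rightarrow> real \<Rightarrow> bool" where
  "absorbs c w n j i t \<longleftrightarrow>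
     1 \<le> i \<and> i < j \<and> j \<le> n \<and> 0 \<le> t \<and>
     present c w n i t \<and> present c w n j t \<and> pos c w i t = pos c w j t"

lemma present_iff_not_absorbed:
  assumes c: "strict_mono_on {1..n} c" and i: "i \<in> {1..n}"
  shows "present c w n i t \<longleftrightarrow> \<not> (\<exists>j. \<exists>s<t. absorbs c w n j i s)"
proof
  assume "present c w n i t"
  then show "\<not> (\<exists>j. \<exists>s<t. absorbs c w n j i s)"
    by (subst (asm) present.simps) (force simp: absorbs_def)
next
  assume no: "\<not> (\<exists>j. \<exists>s<t. absorbs c w n j i s)"
  define M where
    "M = {s\<in>{0..<t}. \<exists>j\<in>{i<..n}. pos c w i s = pos c w j s \<and> present c w n j s}"
  show "present c w n i t"
  proof (rule ccontr)
    assume "\<not> present c w n i t"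
    then have ne: "M \<noteq> {}"
      by (subst (asm) present.simps) (auto simp: M_def)
    have "s = (w i - w j) / (c j - c i)"
      if "j \<in> {i<..n}" and "pos c w i s = pos c w j s" for s j
    proof -
      have "c i < c j" using strict_mono_onD[OF c] i that(1) by auto
      with that(2) show ?thesis by (simp add: pos_def field_simps)
    qed
    then have "M \<subseteq> (\<lambda>j. (w i - w j) / (c j - c i)) ` {i<..n}"
      unfolding M_def by blast
    then have fin: "finite M" by (rule finite_subset) simp
    define m where "m = Min M"
    have m: "m \<in> M" unfolding m_def using fin ne by (rule Min_in)
    have least: "m \<le> s" if "s \<in> M" for s
      unfolding m_def using fin that by (rule Min_le)
    have "present c w n i m"
    proof (rule ccontr)
      assume "\<not> present c w n i m"
      then obtain j s where "j \<in> {i<..n}" "s \<in> {0..<m}"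
        "pos c w i s = pos c w j s" "present c w n j s"
        by (subst (asm) present.simps) blast
      moreover have "m < t" using m by (simp add: M_def)
      ultimately have "s \<in> M" and "s < m" by (auto simp: M_def)
      with least show False by fastforce
    qed
    with m i have "\<exists>j. absorbs c w n j i m \<and> m < t"
      by (auto simp: M_def absorbs_def)
    with no show False by blast
  qed
qed

definition generic :: "(nat \<Rightarrow> real) \<Rightarrow> nat \<Rightarrow> (nat \<Rightarrow> real) \<Rightarrow> bool" where
  "generic c n w \<longleftrightarrow>
     (\<forall>t\<ge>0. \<forall>x. card {i\<in>{1..n}. present c w n i t \<and> pos c w i t = x} \<le> 2)"

text \<open>Maps \<open>[n-1] \<rightarrow> [n]\<close> are extensional functions, so that equal maps are equal as terms.\<close>

definition has_collision_pattern ::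
    "(nat \<Rightarrow> real) \<Rightarrow> nat \<Rightarrow> (nat \<Rightarrow> real) \<Rightarrow> (nat \<Rightarrow> nat) \<Rightarrow> bool" where
  "has_collision_pattern c n w f \<longleftrightarrow>
     f \<in> {1..n-1} \<rightarrow>\<^sub>E {1..n} \<and> (\<forall>i\<in>{1..n-1}. \<exists>t. absorbs c w n (f i) i t)"

definition collision_patterns :: "(nat \<Rightarrow> real) \<Rightarrow> nat \<Rightarrow> (nat \<Rightarrow> nat) set" where
  "collision_patterns c n =
     {f. \<exists>w. mono_on {1..n} (\<lambda>i. - w i) \<and> generic c n w \<and> has_collision_pattern c n w f}"

definition brackets :: "nat \<Rightarrow> nat set set" where
  "brackets n = {{i..j} | i j. 1 \<le> i \<and> i < j \<and> j \<le> n}"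

definition bracketing :: "nat \<Rightarrow> nat set set \<Rightarrow> bool" where
  "bracketing n B \<longleftrightarrow>
     B \<subseteq> brackets n \<and> {1..n} \<in> B \<and>
     (\<forall>I\<in>B. \<forall>J\<in>B. I \<subseteq> J \<or> J \<subseteq> I \<or> I \<inter> J = {})"

definition complete_bracketings :: "nat \<Rightarrow> nat set set set" where
  "complete_bracketings n = {B. bracketing n B \<and> card B = n - 1}"

end

theory Submission
  imports Defs
begin

text \<open>Both sets are matched with the non-crossing maps \<open>f\<close>, those with \<open>i < f i\<close> and
  \<open>f k \<le> f i\<close> for \<open>i < k < f i\<close>. Surviving particles never overtake each other, so a particle
  \<open>k\<close> between \<open>i\<close> and its absorber \<open>f i\<close> has to disappear before \<open>i\<close> does, into a particle
  that is not beyond \<open>f i\<close>; hence collision patterns are non-crossing. Conversely, prescribe that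
  \<open>i\<close> is absorbed at time \<open>n * f i - i\<close>. These times increase along inclusion of the clusters,
  which is all that is needed for the locations computed backwards from them to realise \<open>f\<close>. On
  the other side, in a complete bracketing each gap between \<open>i\<close> and \<open>i + 1\<close> belongs to exactly
  one bracket, the smallest one containing both, and \<open>f i\<close> is the right end of that bracket.\<close>

section \<open>Non-crossing maps\<close>

definition noncrossing :: "nat \<Rightarrow> (nat \<Rightarrow> nat) set" where
  "noncrossing n =
     {f \<in> {1..n-1} \<rightarrow>\<^sub>E {1..n}. \<forall>i\<in>{1..n-1}. i < f i \<and> (\<forall>k. i < k \<and> k < f i \<longrightarrow> f k \<le> f i)}"

lemma noncrossingD:
  assumes "f \<in> noncrossing n" "1 \<le> i" "i < n"
  shows "i < f i" "f i \<le> n" "\<And>k. i < k \<Longrightarrow> k < f i \<Longrightarrow> f k \<le> f i"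
proof -
  from assms(2,3) have i: "i \<in> {1..n-1}" by auto
  from i assms(1) show "i < f i" and "\<And>k. i < k \<Longrightarrow> k < f i \<Longrightarrow> f k \<le> f i"
    unfolding noncrossing_def by blast+
  from i assms(1) have "f i \<in> {1..n}" unfolding noncrossing_def by blast
  then show "f i \<le> n" by simp
qed

section \<open>Collision patterns are non-crossing\<close>

lemma present_antimono:
  assumes "present c w n i t" "s \<le> t"
  shows "present c w n i s"
  using assms by (subst (asm) present.simps, subst present.simps) force

text \<open>Two lines that start in weak order and end in the opposite strict order cross at some
  earlier time \<open>s\<close>. As \<open>j\<close> survives until \<open>t\<close>, it was present
  at that crossing and would have absorbed \<open>i\<close> before \<open>t\<close>.\<close>

lemma present_pos_mono:
  assumes c: "strict_mono_on {1..n} c" and w: "mono_on {1..n} (\<lambda>i. - w i)"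
    and "1 \<le> i" "i < j" "j \<le> n" and "0 \<le> t"
    and "present c w n i t" "present c w n j t"
  shows "pos c w i t \<le> pos c w j t"
proof (rule ccontr)
  assume less: "\<not> pos c w i t \<le> pos c w j t"
  have cc: "c i < c j" using strict_mono_onD[OF c, of i j] assms by auto
  have ww: "w j \<le> w i" using mono_onD[OF w, of i j] assms by auto
  define s where "s = (w i - w j) / (c j - c i)"
  have "0 \<le> s" using cc ww by (simp add: s_def)
  moreover have "s < t" using less cc by (simp add: s_def pos_def field_simps)
  moreover have "pos c w i s = pos c w j s"
  proof -
    have "s * (c j - c i) = w i - w j" using cc by (simp add: s_def)
    then show ?thesis by (simp add: pos_def algebra_simps)
  qed
  moreover have "present c w n j s" using present_antimono assms(8) \<open>s < t\<close> by fastforce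
  ultimately have "\<not> present c w n i t" using assms by (subst present.simps) force
  with assms show False by blast
qed

text \<open>A surviving \<open>k\<close> would be squeezed between \<open>i\<close> and
  \<open>j\<close> at their meeting point, which makes three survivors at one place.\<close>

lemma not_present_between:
  assumes c: "strict_mono_on {1..n} c" and w: "mono_on {1..n} (\<lambda>i. - w i)"
    and g: "generic c n w" and a: "absorbs c w n j i t" and k: "i < k" "k < j"
  shows "\<not> present c w n k t"
proof
  assume p: "present c w n k t"
  from a have A: "1 \<le> i" "i < j" "j \<le> n" "0 \<le> t" "present c w n i t" "present c w n j t"
    "pos c w i t = pos c w j t" by (auto simp: absorbs_def)
  have "pos c w i t \<le> pos c w k t" "pos c w k t \<le> pos c w j t"
    using present_pos_mono[OF c w, of i k t] present_pos_mono[OF c w, of k j t] A p k by simp_all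
  then have "{i, k, j} \<subseteq> {l\<in>{1..n}. present c w n l t \<and> pos c w l t = pos c w i t}"
    using A p k by auto
  then have "card {i, k, j} \<le> card {l\<in>{1..n}. present c w n l t \<and> pos c w l t = pos c w i t}"
    by (intro card_mono) auto
  moreover have "card {i, k, j} = 3" using k by simp
  moreover have "card {l\<in>{1..n}. present c w n l t \<and> pos c w l t = pos c w i t} \<le> 2"
    using g A(4) unfolding generic_def by blast
  ultimately show False by linarith
qed

lemma collision_pattern_noncrossing:
  assumes c: "strict_mono_on {1..n} c" and f: "f \<in> collision_patterns c n"
  shows "f \<in> noncrossing n"
proof -
  from f obtain w where w: "mono_on {1..n} (\<lambda>i. - w i)" and g: "generic c n w"
    and fE: "f \<in> {1..n-1} \<rightarrow>\<^sub>E {1..n}" and ab: "\<And>i. i \<in> {1..n-1} \<Longrightarrow> \<exists>t. absorbs c w n (f i) i t"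
    unfolding collision_patterns_def has_collision_pattern_def by blast
  have "f k \<le> f i" if i: "i \<in> {1..n-1}" and k: "i < k" "k < f i" for i k
  proof (rule ccontr)
    assume less: "\<not> f k \<le> f i"
    obtain t where t: "absorbs c w n (f i) i t" using ab[OF i] by blast
    then have "f i \<le> n" by (simp add: absorbs_def)
    with k i have "k \<in> {1..n-1}" by auto
    then obtain s where s: "absorbs c w n (f k) k s" using ab by blast
    have "\<not> present c w n k t" using not_present_between[OF c w g t k] .
    \<comment> \<open>A particle still counts as present at the moment of its own absorption, so
      \<open>k\<close> being gone at \<open>t\<close> puts \<open>s\<close> strictly before
      \<open>t\<close>. The roles then swap: \<open>f i\<close> is a survivor lying between
      \<open>k\<close> and \<open>f k\<close> at time \<open>s\<close>.\<close>
    then have "s < t" using present_antimono s unfolding absorbs_def by (meson not_le)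
    then have "present c w n (f i) s" using t present_antimono unfolding absorbs_def by fastforce
    moreover have "\<not> present c w n (f i) s"
      using not_present_between[OF c w g s k(2)] less by simp
    ultimately show False by blast
  qed
  moreover have "i < f i" if "i \<in> {1..n-1}" for i
    using ab[OF that] by (auto simp: absorbs_def)
  ultimately show ?thesis using fE unfolding noncrossing_def by blast
qed

section \<open>Non-crossing maps are collision patterns\<close>

text \<open>A lexicographic order written as a number: first by the absorber, then, for a common
  absorber, larger labels earlier, so that the nearest particle is absorbed first.\<close>

definition merge_time :: "nat \<Rightarrow> (nat \<Rightarrow> nat) \<Rightarrow> nat \<Rightarrow> real" where
  "merge_time n f i = real n * real (f i) - real i"

text \<open>The equation \<open>pos c w i t = pos c w (f i) t\<close> at \<open>t = merge_time n f i\<close>, solved for \<open>w i\<close>.\<close>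

function merge_loc :: "(nat \<Rightarrow> real) \<Rightarrow> nat \<Rightarrow> (nat \<Rightarrow> nat) \<Rightarrow> nat \<Rightarrow> real" where
  "merge_loc c n f i =
     (if i < f i \<and> f i \<le> n then merge_loc c n f (f i) + (c (f i) - c i) * merge_time n f i else 0)"
  by pat_completeness auto
text \<open>The guard makes \<open>n - i\<close> decrease. It fails at \<open>i = n\<close> whatever
  value \<open>f n\<close> has, so particle \<open>n\<close> is put at the origin.\<close>

termination
  by (relation "Wellfounded.measure (\<lambda>(c, n, f, i). n - i)") auto

declare merge_loc.simps [simp del]

text \<open>Raising the absorber by one gains \<open>n\<close>, which outweighs the loss
  \<open>k - i < n\<close> from the labels.\<close>

lemma merge_time_less:
  assumes "f i < f k \<or> f i = f k \<and> k < i" and "1 \<le> i" "k \<le> n"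
  shows "merge_time n f i < merge_time n f k"
proof (cases "f i < f k")
  case True
  then have "real n * (real (f i) + 1) \<le> real n * real (f k)" by (intro mult_left_mono) auto
  with assms show ?thesis by (simp add: merge_time_def algebra_simps)
qed (use assms in \<open>auto simp: merge_time_def\<close>)

lemma merge_time_pos:
  assumes "f \<in> noncrossing n" "1 \<le> i" "i < n"
  shows "0 < merge_time n f i"
proof -
  have "1 \<le> f i" using noncrossingD(1)[OF assms] by simp
  then have "real n * 1 \<le> real n * real (f i)" by (intro mult_left_mono) auto
  moreover have "real i < real n" using assms by simp
  ultimately show ?thesis unfolding merge_time_def by linarith
qed

lemma merge_pos_diff:
  assumes "f \<in> noncrossing n" "1 \<le> i" "i < n"
  shows "pos c (merge_loc c n f) (f i) s - pos c (merge_loc c n f) i s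
    = (c (f i) - c i) * (merge_time n f i - s)"
  using noncrossingD[OF assms]
  by (subst (2) pos_def, subst merge_loc.simps) (simp add: pos_def algebra_simps)

text \<open>Before \<open>i\<close> is due it stays strictly left of every larger label not yet
  overdue. For \<open>j = f i\<close> this is the sign of the linear gap, and for \<open>j\<close>
  beyond \<open>f i\<close> the comparison passes through \<open>f i\<close>. For \<open>j\<close>
  before \<open>f i\<close>, it is made at the merge time of \<open>j\<close>, where
  \<open>j\<close> may be replaced by \<open>f j\<close>, and then carried back in time.\<close>

lemma merge_pos_less:
  assumes c: "strict_mono_on {1..n} c" and f: "f \<in> noncrossing n"
    and "1 \<le> i" "i < j" "j \<le> n" "s < merge_time n f i" "j = n \<or> s \<le> merge_time n f j"
  shows "pos c (merge_loc c n f) i s < pos c (merge_loc c n f) j s"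
  using assms(3-)
proof (induction "(n - i) + (n - j)" arbitrary: i j s rule: less_induct)
  case less
  let ?P = "pos c (merge_loc c n f)" and ?t = "merge_time n f"
  have i: "1 \<le> i" "i < n" using less.prems by auto
  note fi = noncrossingD[OF f i]
  have ci: "c i < c j" if "i < j" "j \<le> n" for j
    using strict_mono_onD[OF c, of i j] that i by auto
  have direct: "?P i s < ?P (f i) s" if "s < ?t i" for s
  proof -
    have "0 < (c (f i) - c i) * (?t i - s)" using ci[OF fi(1,2)] that by simp
    then show ?thesis using merge_pos_diff[OF f i] by (metis diff_gt_0_iff_gt)
  qed
  consider "j = f i" | "f i < j" | "j < f i" by linarith
  then show ?case
  proof cases
    case 1
    then show ?thesis using direct less.prems by simp
  next
    case 2
    then have fin: "1 \<le> f i" "f i < n" using fi less.prems by auto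
    have "?t i < ?t (f i)" using noncrossingD(1)[OF f fin] i fin by (intro merge_time_less) auto
    then have "?P (f i) s < ?P j s"
      using less.prems 2 fi fin by (intro less.hyps) auto
    with direct less.prems show ?thesis by fastforce
  next
    case 3
    then have j: "1 \<le> j" "j < n" using fi less.prems by auto
    note fj = noncrossingD[OF f j]
    have fle: "f j \<le> f i" using fi(3) less.prems 3 by blast
    \<comment> \<open>If \<open>f j = f i\<close>, the tie-break by label decides in favour of the
      nearer particle \<open>j\<close>.\<close>
    then have tj: "?t j < ?t i" using less.prems j i by (intro merge_time_less) auto
    have "?P i (?t j) < ?P (f j) (?t j)"
    proof (cases "f j = n")
      case True
      then have "f i = f j" using fle fi by simp
      with direct tj show ?thesis by simp
    next
      case False
      then have fjn: "1 \<le> f j" "f j < n" using fj by auto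
      have "?t j < ?t (f j)" using noncrossingD(1)[OF f fjn] j fjn by (intro merge_time_less) auto
      then show ?thesis using less.prems fj tj fjn by (intro less.hyps) auto
    qed
    also have "?P (f j) (?t j) = ?P j (?t j)" using merge_pos_diff[OF f j, of c "?t j"] by simp
    finally have "?P i (?t j) < ?P j (?t j)" .
    \<comment> \<open>The distance from \<open>i\<close> up to \<open>j\<close> shrinks at rate
      \<open>c j - c i\<close>, so it is at least as large at the earlier time
      \<open>s\<close>.\<close>
    moreover have "(c j - c i) * s \<le> (c j - c i) * ?t j"
      using ci[of j] less.prems j by (intro mult_left_mono) auto
    ultimately show ?thesis by (simp add: pos_def algebra_simps)
  qed
qed

text \<open>Induction from the label \<open>n\<close> downwards. By \<open>merge_pos_less\<close>,
  \<open>i\<close> meets no surviving larger label before its merge time. At that time it meets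
  \<open>f i\<close>, which is itself due only later or never.\<close>

lemma present_merge_iff:
  assumes c: "strict_mono_on {1..n} c" and f: "f \<in> noncrossing n" and "1 \<le> i" "i \<le> n"
  shows "present c (merge_loc c n f) n i t \<longleftrightarrow> i = n \<or> t \<le> merge_time n f i"
  using assms(3,4)
proof (induction "n - i" arbitrary: i t rule: less_induct)
  case less
  let ?P = "pos c (merge_loc c n f)" and ?t = "merge_time n f"
  show ?case
  proof (cases "i = n")
    case True
    then show ?thesis by (subst present.simps) simp
  next
    case False
    then have i: "1 \<le> i" "i < n" using less.prems by auto
    note fi = noncrossingD[OF f i]
    have IH: "present c (merge_loc c n f) n j s \<longleftrightarrow> j = n \<or> s \<le> ?t j" if "i < j" "j \<le> n" for j s
      using that less.prems by (intro less.hyps) auto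
    have "(\<exists>j\<in>{i<..n}. \<exists>s\<in>{0..<t}. ?P i s = ?P j s \<and> present c (merge_loc c n f) n j s)
      \<longleftrightarrow> ?t i < t" (is "?L \<longleftrightarrow> _")
    proof
      assume ?L
      then obtain j s where js: "i < j" "j \<le> n" "s < t" "?P i s = ?P j s" "j = n \<or> s \<le> ?t j"
        using IH by auto
      then have "\<not> s < ?t i" using merge_pos_less[OF c f, of i j s] i by auto
      then show "?t i < t" using js by simp
    next
      assume "?t i < t"
      moreover have "?P i (?t i) = ?P (f i) (?t i)"
        using merge_pos_diff[OF f i, of c "?t i"] by simp
      moreover have "f i = n \<or> ?t i \<le> ?t (f i)"
      proof (cases "f i = n")
        case False
        then have fin: "1 \<le> f i" "f i < n" using fi by auto
        have "?t i < ?t (f i)" using noncrossingD(1)[OF f fin] i fin by (intro merge_time_less) auto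
        then show ?thesis by simp
      qed simp
      moreover have "0 \<le> ?t i" using merge_time_pos[OF f i] by simp
      ultimately show ?L using fi IH by (intro bexI[of _ "f i"] bexI[of _ "?t i"]) auto
    qed
    with False show ?thesis by (subst present.simps) auto
  qed
qed

lemma noncrossing_collision_pattern:
  assumes c: "strict_mono_on {1..n} c" and f: "f \<in> noncrossing n"
  shows "f \<in> collision_patterns c n"
proof -
  let ?w = "merge_loc c n f" and ?t = "merge_time n f"
  note present = present_merge_iff[OF c f]
  have "mono_on {1..n} (\<lambda>i. - ?w i)"
  proof (rule mono_onI)
    fix i j assume ij: "i \<in> {1..n}" "j \<in> {1..n}" "i \<le> j"
    show "- ?w i \<le> - ?w j"
    proof (cases "i = j")
      case False
      then have "pos c ?w i 0 < pos c ?w j 0"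
        using ij merge_time_pos[OF f, of i] merge_time_pos[OF f, of j]
        by (intro merge_pos_less[OF c f]) fastforce+
      then show ?thesis by (simp add: pos_def)
    qed simp
  qed
  moreover have "generic c n ?w"
    unfolding generic_def
  proof (intro allI impI)
    fix t x :: real assume "0 \<le> t"
    let ?S = "{i\<in>{1..n}. present c ?w n i t \<and> pos c ?w i t = x}"
    have fin: "finite ?S" by simp
    \<comment> \<open>Every survivor at \<open>x\<close> except the one with the largest label must
      be exactly due, since \<open>merge_pos_less\<close> would otherwise separate the two. Distinct
      labels are due at distinct times, so there is at most one such survivor.\<close>
    have t: "i < n \<and> t = ?t i" if "i \<in> ?S - {Max ?S}" for i
    proof -
      have "Max ?S \<in> ?S" using that by (intro Max_in fin) blast
      moreover have "i < Max ?S" using that Max_ge[OF fin, of i] by (intro le_neq_trans) blast+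
      ultimately show ?thesis
        using that present[of i t] present[of "Max ?S" t] merge_pos_less[OF c f, of i "Max ?S" t]
        by force
    qed
    have "i = j" if "i \<in> ?S - {Max ?S}" "j \<in> ?S - {Max ?S}" for i j
    proof -
      have "?t i = ?t j" using t[OF that(1)] t[OF that(2)] by simp
      then show ?thesis
        using that merge_time_less[of f i j n] merge_time_less[of f j i n] by force
    qed
    then have "card (?S - {Max ?S}) \<le> 1" by (simp add: card_le_Suc0_iff_eq)
    then show "card ?S \<le> 2" using card_Diff1_le[of ?S "Max ?S"] card_Diff_singleton_if[of ?S "Max ?S"]
      by (simp split: if_splits)
  qed
  moreover have "absorbs c ?w n (f i) i (?t i)" if "i \<in> {1..n-1}" for i
  proof -
    from that have i: "1 \<le> i" "i < n" by auto
    note fi = noncrossingD[OF f i]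
    have "present c ?w n (f i) (?t i)"
    proof (cases "f i = n")
      case False
      then have fin: "1 \<le> f i" "f i < n" using fi by auto
      have "?t i < ?t (f i)" using noncrossingD(1)[OF f fin] i fin by (intro merge_time_less) auto
      then show ?thesis using present fin by simp
    qed (use present i in simp)
    then show ?thesis using i fi present[of i] merge_time_pos[OF f i]
        merge_pos_diff[OF f i, of c "?t i"] by (simp add: absorbs_def)
  qed
  moreover have "f \<in> {1..n-1} \<rightarrow>\<^sub>E {1..n}" using f by (simp add: noncrossing_def)
  ultimately show ?thesis unfolding collision_patterns_def has_collision_pattern_def by blast
qed

section \<open>Non-crossing maps and complete bracketings\<close>

text \<open>For non-crossing \<open>f\<close> the labels from here to \<open>i\<close> are those
  whose iterates under \<open>f\<close> reach \<open>i\<close>, that is, the particles already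
  merged into \<open>i\<close> when \<open>i\<close> is absorbed.\<close>

definition left_end :: "(nat \<Rightarrow> nat) \<Rightarrow> nat \<Rightarrow> nat" where
  "left_end f i = (LEAST a. 1 \<le> a \<and> (\<forall>k\<in>{a..<i}. f k \<le> i))"

text \<open>The cluster created when \<open>i\<close> is absorbed.\<close>

definition cluster :: "(nat \<Rightarrow> nat) \<Rightarrow> nat \<Rightarrow> nat set" where
  "cluster f i = {left_end f i..f i}"

text \<open>The intersection avoids a choice. In a bracketing, the brackets over a common gap form a
  chain, so it is itself a bracket.\<close>

definition smallest :: "nat set set \<Rightarrow> nat \<Rightarrow> nat set" where
  "smallest B i = \<Inter>{I\<in>B. i \<in> I \<and> Suc i \<in> I}"

section \<open>Clusters of a non-crossing map\<close>

lemma left_end_props: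
  assumes "1 \<le> i"
  shows "1 \<le> left_end f i" "left_end f i \<le> i"
    "\<And>k. left_end f i \<le> k \<Longrightarrow> k < i \<Longrightarrow> f k \<le> i"
proof -
  let ?P = "\<lambda>a. 1 \<le> a \<and> (\<forall>k\<in>{a..<i}. f k \<le> i)"
  have P: "?P i" using assms by simp
  show "left_end f i \<le> i" unfolding left_end_def using P by (rule Least_le)
  have "?P (left_end f i)" unfolding left_end_def using P by (rule LeastI)
  then show "1 \<le> left_end f i" "\<And>k. left_end f i \<le> k \<Longrightarrow> k < i \<Longrightarrow> f k \<le> i" by auto
qed

lemma left_end_eqI:
  assumes "1 \<le> a" and "\<And>k. a \<le> k \<Longrightarrow> k < i \<Longrightarrow> f k \<le> i"
    and "a \<le> i" and "1 < a \<Longrightarrow> i < f (a - 1)"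
  shows "left_end f i = a"
  unfolding left_end_def
proof (rule Least_equality)
  fix b assume b: "1 \<le> b \<and> (\<forall>k\<in>{b..<i}. f k \<le> i)"
  show "a \<le> b"
  proof (rule ccontr)
    assume "\<not> a \<le> b"
    then have "a - 1 \<in> {b..<i}" "1 < a" using b assms by auto
    with b assms(4) show False by fastforce
  qed
qed (use assms in auto)

lemma left_end_le:
  assumes "1 \<le> a" "\<And>k. a \<le> k \<Longrightarrow> k < i \<Longrightarrow> f k \<le> i"
  shows "left_end f i \<le> a"
  unfolding left_end_def using assms by (intro Least_le) auto

lemma left_end_maximal:
  assumes "1 \<le> i" "1 < left_end f i"
  shows "i < f (left_end f i - 1)"
proof (rule ccontr)
  let ?a = "left_end f i"
  assume *: "\<not> i < f (?a - 1)"
  have "f k \<le> i" if "?a - 1 \<le> k" "k < i" for k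
    using that * left_end_props(3)[OF assms(1), of f k] by (cases "k = ?a - 1") auto
  then have "?a \<le> ?a - 1" using assms(2) by (intro left_end_le) auto
  with assms(2) show False by simp
qed

text \<open>The inequalities in each alternative record which cluster covers the gap of the other;
  \<open>smallest_clusters\<close> relies on them.\<close>

lemma cluster_laminar:
  assumes f: "f \<in> noncrossing n" and i: "1 \<le> i" and ij: "i < j" and j: "j < n"
  shows "j < f i \<and> i < left_end f j \<and> cluster f j \<subset> cluster f i
    \<or> f i \<le> j \<and> left_end f j \<le> i \<and> cluster f i \<subset> cluster f j
    \<or> i < left_end f j \<and> cluster f i \<inter> cluster f j = {}"
proof -
  have i': "1 \<le> i" "i < n" and j': "1 \<le> j" "j < n" using i ij j by auto
  note fi = noncrossingD[OF f i'] and fj = noncrossingD[OF f j']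
  note li = left_end_props[OF i, of f] and lj = left_end_props[OF j'(1), of f]
  consider "j < f i" | "f i \<le> j" "left_end f j \<le> i" | "f i \<le> j" "i < left_end f j" by linarith
  then show ?thesis
  proof cases
    case 1
    then have "i < left_end f j" using lj(3)[of i] ij by force
    moreover have "f j \<le> f i" using fi(3) ij 1 by blast
    ultimately have "cluster f j \<subset> cluster f i" using li lj fj
      by (simp add: cluster_def psubset_eq)
    with 1 \<open>i < left_end f j\<close> show ?thesis by blast
  next
    case 2
    have "left_end f j \<le> left_end f i"
    proof (rule ccontr)
      \<comment> \<open>Otherwise the label just before \<open>left_end f j\<close> lies in the run
        left of \<open>i\<close>, so its absorber is at most \<open>i\<close>, while maximality of
        the run of \<open>j\<close> puts that absorber beyond \<open>j\<close>.\<close>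
      assume *: "\<not> ?thesis"
      then have "1 < left_end f j" using li by simp
      then have "j < f (left_end f j - 1)" using left_end_maximal j' by blast
      moreover have "f (left_end f j - 1) \<le> i" using * 2 by (intro li(3)) auto
      ultimately show False using ij by simp
    qed
    then have "cluster f i \<subset> cluster f j" using li lj fi fj 2
      by (simp add: cluster_def psubset_eq)
    with 2 show ?thesis by blast
  next
    case 3
    have "f i < left_end f j"
    proof (rule ccontr)
      let ?k = "left_end f j - 1"
      \<comment> \<open>Here \<open>?k\<close> lies in \<open>{i..<f i}\<close>, so its absorber is
        at most \<open>f i\<close>, hence at most \<open>j\<close>, against maximality of the run of
        \<open>j\<close>.\<close>
      assume *: "\<not> ?thesis"
      have "j < f ?k" using left_end_maximal[of j f] j' 3 i by simp
      moreover have "f ?k \<le> f i" using * 3 fi(3)[of ?k] i by (cases "?k = i") auto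
      ultimately show False using 3 by simp
    qed
    with 3 show ?thesis by (auto simp: cluster_def)
  qed
qed

lemma clusters_complete_bracketing:
  assumes n: "2 \<le> n" and f: "f \<in> noncrossing n"
  shows "cluster f ` {1..n-1} \<in> complete_bracketings n"
proof -
  have "inj_on (cluster f) {1..n-1}"
  proof (rule linorder_inj_onI)
    fix i j assume "i < j" and ij: "i \<in> {1..n-1}" "j \<in> {1..n-1}"
    have i: "1 \<le> i" "i < n" and j: "j < n" using ij by auto
    have "i \<in> cluster f i"
      using left_end_props(2)[OF i(1), of f] noncrossingD(1)[OF f i] by (simp add: cluster_def)
    then show "cluster f i \<noteq> cluster f j"
      using cluster_laminar[OF f i(1) \<open>i < j\<close> j] by blast
  qed auto
  then have "card (cluster f ` {1..n-1}) = n - 1" by (simp add: card_image)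
  moreover have "cluster f ` {1..n-1} \<subseteq> brackets n"
  proof
    fix I assume "I \<in> cluster f ` {1..n-1}"
    then obtain i where i: "1 \<le> i" "i < n" "I = cluster f i" by auto
    show "I \<in> brackets n"
      using left_end_props(1,2)[OF i(1), of f] noncrossingD(1,2)[OF f i(1,2)] i(3)
      unfolding brackets_def cluster_def
      by (intro CollectI exI[of _ "left_end f i"] exI[of _ "f i"]) auto
  qed
  moreover have "{1..n} \<in> cluster f ` {1..n-1}"
  proof -
    \<comment> \<open>The whole interval is the cluster of the last merge, that of the smallest
      \<open>i\<close> absorbed by \<open>n\<close>.\<close>
    let ?Q = "\<lambda>i. 1 \<le> i \<and> i < n \<and> f i = n"
    have n': "1 \<le> n - 1" "n - 1 < n" using n by auto
    have "?Q (n - 1)" using noncrossingD(1,2)[OF f n'] n' by linarith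
    then obtain i where i: "?Q i" and least: "\<And>k. ?Q k \<Longrightarrow> i \<le> k"
      using ex_has_least_nat[of ?Q "n - 1" "\<lambda>k. k"] by blast
    have "left_end f i = 1"
    proof (rule left_end_eqI)
      fix k assume k: "1 \<le> k" "k < i"
      then have k': "1 \<le> k" "k < n" using i by auto
      show "f k \<le> i"
      proof (rule ccontr)
        assume "\<not> f k \<le> i"
        then have "n \<le> f k" using noncrossingD(3)[OF f k', of i] k i by simp
        then have "?Q k" using noncrossingD(2)[OF f k'] k' by simp
        with least k show False by force
      qed
    qed (use i in auto)
    then have "{1..n} = cluster f i" using i by (simp add: cluster_def)
    then show ?thesis using i by auto
  qed
  moreover have "I \<subseteq> J \<or> J \<subseteq> I \<or> I \<inter> J = {}"
    if "I \<in> cluster f ` {1..n-1}" "J \<in> cluster f ` {1..n-1}" for I J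
  proof -
    obtain i j where ij: "i \<in> {1..n-1}" "j \<in> {1..n-1}" "I = cluster f i" "J = cluster f j"
      using \<open>I \<in> _\<close> \<open>J \<in> _\<close> by blast
    then have ij': "1 \<le> i" "i < n" "1 \<le> j" "j < n" by auto
    consider "i < j" | "i = j" | "j < i" by linarith
    then show ?thesis
    proof cases
      case 1
      then show ?thesis using cluster_laminar[OF f ij'(1) 1 ij'(4)] ij by blast
    next
      case 3
      then show ?thesis using cluster_laminar[OF f ij'(3) 3 ij'(2)] ij by blast
    qed (use ij in simp)
  qed
  ultimately show ?thesis by (simp add: complete_bracketings_def bracketing_def)
qed

text \<open>This recovers the cluster of \<open>i\<close> from the unlabelled set of clusters: any
  cluster covering the gap after \<open>i\<close> contains that of \<open>i\<close>.\<close>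

lemma smallest_clusters:
  assumes f: "f \<in> noncrossing n" and i: "1 \<le> i" "i < n"
  shows "smallest (cluster f ` {1..n-1}) i = cluster f i"
proof -
  have "i \<in> cluster f i" "Suc i \<in> cluster f i"
    using left_end_props(2)[OF i(1), of f] noncrossingD(1)[OF f i] by (auto simp: cluster_def)
  moreover have "cluster f i \<subseteq> cluster f j"
    if j: "j \<in> {1..n-1}" and "i \<in> cluster f j" "Suc i \<in> cluster f j" for j
  proof -
    have ij: "left_end f j \<le> i" "i < f j" and j': "1 \<le> j" "j < n"
      using that by (auto simp: cluster_def)
    consider "i < j" | "i = j" | "j < i" by linarith
    then show ?thesis
    proof cases
      case 1
      then show ?thesis using cluster_laminar[OF f i(1) 1 j'(2)] ij by auto
    next
      case 3
      then show ?thesis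
        using cluster_laminar[OF f j'(1) 3 i(2)] \<open>i \<in> cluster f j\<close> \<open>i \<in> cluster f i\<close> ij by auto
    qed simp
  qed
  ultimately show ?thesis using i unfolding smallest_def by (intro equalityI) force+
qed

section \<open>From bracketings back to non-crossing maps\<close>

lemma bracketingD:
  assumes "bracketing n B"
  shows "\<And>I. I \<in> B \<Longrightarrow> \<exists>a b. I = {a..b} \<and> 1 \<le> a \<and> a < b \<and> b \<le> n" "{1..n} \<in> B"
    "\<And>I J. I \<in> B \<Longrightarrow> J \<in> B \<Longrightarrow> I \<subseteq> J \<or> J \<subseteq> I \<or> I \<inter> J = {}"
  using assms unfolding bracketing_def brackets_def by blast+

lemma smallest_props:
  assumes B: "bracketing n B" and i: "1 \<le> i" "i < n"
  shows "smallest B i \<in> B" "i \<in> smallest B i" "Suc i \<in> smallest B i"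
    "\<And>I. I \<in> B \<Longrightarrow> i \<in> I \<Longrightarrow> Suc i \<in> I \<Longrightarrow> smallest B i \<subseteq> I"
proof -
  let ?P = "\<lambda>I. I \<in> B \<and> i \<in> I \<and> Suc i \<in> I"
  have "?P {1..n}" using bracketingD(2)[OF B] i by auto
  \<comment> \<open>Brackets over the same gap meet, so they are nested, and one of least
    cardinality lies in all of them.\<close>
  then obtain I where I: "?P I" and min: "\<And>J. ?P J \<Longrightarrow> card I \<le> card J"
    using ex_has_least_nat[of ?P "{1..n}" card] by blast
  have "I \<subseteq> J" if J: "?P J" for J
  proof -
    have "I \<subseteq> J \<or> J \<subseteq> I" using bracketingD(3)[OF B, of I J] I J by auto
    moreover have "finite I" using bracketingD(1)[OF B, of I] I by auto
    ultimately show ?thesis using min[OF J] card_seteq by blast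
  qed
  then have "smallest B i = I" unfolding smallest_def using I by (intro equalityI) blast+
  with I show "smallest B i \<in> B" "i \<in> smallest B i" "Suc i \<in> smallest B i" by auto
  show "\<And>I. I \<in> B \<Longrightarrow> i \<in> I \<Longrightarrow> Suc i \<in> I \<Longrightarrow> smallest B i \<subseteq> I"
    unfolding smallest_def by blast
qed

text \<open>If every gap of \<open>{a..b}\<close> were covered by a smaller bracket, then the longest smaller bracket
  starting at \<open>a\<close> could be extended beyond its right end.\<close>

lemma smallest_surj:
  assumes B: "bracketing n B"
  shows "smallest B ` {1..n-1} = B"
proof
  show "smallest B ` {1..n-1} \<subseteq> B" using smallest_props(1)[OF B] by auto
  show "B \<subseteq> smallest B ` {1..n-1}"
  proof
    fix I assume I: "I \<in> B"
    obtain a b where ab: "I = {a..b}" "1 \<le> a" "a < b" "b \<le> n" using bracketingD(1)[OF B I] by blast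
    \<comment> \<open>The value \<open>a\<close> stands for the case that no shorter bracket starts
      at \<open>a\<close>; a bracket has at least two elements.\<close>
    define M where "M = {m\<in>{a..<b}. m = a \<or> {a..m} \<in> B}"
    define m where "m = Max M"
    have fin: "finite M" and "a \<in> M" using ab by (auto simp: M_def)
    then have m: "m \<in> M" unfolding m_def by (intro Max_in) auto
    have max: "k \<le> m" if "k \<in> M" for k unfolding m_def using fin that by (rule Max_ge)
    have mab: "a \<le> m" "m < b" and mB: "m = a \<or> {a..m} \<in> B" using m by (auto simp: M_def)
    have mn: "1 \<le> m" "m < n" using mab ab by auto
    let ?J = "smallest B m"
    note J = smallest_props[OF B mn]
    obtain x y where xy: "?J = {x..y}" "x < y" using bracketingD(1)[OF B J(1)] by blast
    have JI: "?J \<subseteq> I" using J(4)[OF I] ab mab by auto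
    then have le: "a \<le> x" "y \<le> b" using xy ab by auto
    have "m \<in> {x..y}" "Suc m \<in> {x..y}" using J(2,3) xy by auto
    then have xm: "x \<le> m" "m < y" by auto
    have "x = a"
    proof (rule ccontr)
      assume "x \<noteq> a"
      then have "a < x" using le by simp
      then have "{a..m} \<in> B" using mB xm by auto
      then have "{a..m} \<subseteq> {x..y} \<or> {x..y} \<subseteq> {a..m} \<or> {a..m} \<inter> {x..y} = {}"
        using bracketingD(3)[OF B, of "{a..m}" "{x..y}"] J(1) xy by simp
      then show False using \<open>a < x\<close> xm by auto
    qed
    have "y = b"
    proof (rule ccontr)
      assume "y \<noteq> b"
      then have "y \<in> M" using le J(1) xy \<open>x = a\<close> by (auto simp: M_def)
      with max xm show False by fastforce
    qed
    then have "I = ?J" using \<open>x = a\<close> xy ab by simp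
    then show "I \<in> smallest B ` {1..n-1}" using mn by auto
  qed
qed

definition right_ends :: "nat \<Rightarrow> nat set set \<Rightarrow> nat \<Rightarrow> nat" where
  "right_ends n B = (\<lambda>i\<in>{1..n-1}. Max (smallest B i))"

lemma smallest_eq_Max:
  assumes B: "bracketing n B" and i: "1 \<le> i" "i < n"
  obtains a where "smallest B i = {a..right_ends n B i}" "1 \<le> a" "a \<le> i"
    "i < right_ends n B i" "right_ends n B i \<le> n"
proof -
  note J = smallest_props[OF B i]
  obtain a b where ab: "smallest B i = {a..b}" "1 \<le> a" "a < b" "b \<le> n"
    using bracketingD(1)[OF B J(1)] by blast
  moreover have "right_ends n B i = b"
    using ab i by (auto simp: right_ends_def intro: Max_eqI)
  ultimately show ?thesis using J(2,3) by (intro that[of a]) auto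
qed

text \<open>If \<open>k\<close> lies strictly between \<open>i\<close> and its right end, the
  bracket chosen for \<open>i\<close> also covers the gap after \<open>k\<close>, hence contains the
  bracket chosen for \<open>k\<close>.\<close>

lemma right_ends_noncrossing:
  assumes B: "bracketing n B"
  shows "right_ends n B \<in> noncrossing n"
proof -
  let ?f = "right_ends n B"
  have le: "i < ?f i \<and> ?f i \<le> n" if "i \<in> {1..n-1}" for i
  proof -
    have "1 \<le> i" "i < n" using that by auto
    then show ?thesis by (rule smallest_eq_Max[OF B]) simp
  qed
  moreover have "?f k \<le> ?f i" if i: "i \<in> {1..n-1}" and k: "i < k" "k < ?f i" for i k
  proof -
    have i': "1 \<le> i" "i < n" using i by auto
    have k': "1 \<le> k" "k < n" using k i le[OF i] by auto
    obtain a where a: "smallest B i = {a..?f i}" "1 \<le> a" "a \<le> i" "i < ?f i" "?f i \<le> n"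
      by (rule smallest_eq_Max[OF B i'])
    obtain b where b: "smallest B k = {b..?f k}" "1 \<le> b" "b \<le> k" "k < ?f k" "?f k \<le> n"
      by (rule smallest_eq_Max[OF B k'])
    have "smallest B k \<subseteq> smallest B i"
      using a k by (intro smallest_props[OF B k'] smallest_props(1)[OF B i']) auto
    then show ?thesis using a b by auto
  qed
  moreover have "?f \<in> {1..n-1} \<rightarrow>\<^sub>E {1..n}"
  proof (rule PiE_I)
    show "?f i \<in> {1..n}" if "i \<in> {1..n-1}" for i using le[OF that] by auto
    show "?f i = undefined" if "i \<notin> {1..n-1}" for i using that unfolding right_ends_def by auto
  qed
  ultimately show ?thesis unfolding noncrossing_def by blast
qed

text \<open>Completeness makes the surjection \<open>smallest B\<close> from \<open>n - 1\<close>
  gaps onto \<open>n - 1\<close> brackets injective, so different gaps have different smallest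
  brackets.\<close>

lemma cluster_right_ends:
  assumes B: "B \<in> complete_bracketings n" and i: "1 \<le> i" "i < n"
  shows "cluster (right_ends n B) i = smallest B i"
proof -
  let ?f = "right_ends n B"
  have br: "bracketing n B" and card: "card B = n - 1"
    using B by (auto simp: complete_bracketings_def)
  have inj: "inj_on (smallest B) {1..n-1}"
    using card smallest_surj[OF br] by (intro eq_card_imp_inj_on) auto
  obtain a where a: "smallest B i = {a..?f i}" "1 \<le> a" "a \<le> i" "i < ?f i" "?f i \<le> n"
    by (rule smallest_eq_Max[OF br i])
  have "left_end ?f i = a"
  proof (rule left_end_eqI)
    fix k assume k: "a \<le> k" "k < i"
    then have k': "1 \<le> k" "k < n" using a i by auto
    obtain b where b: "smallest B k = {b..?f k}" "1 \<le> b" "b \<le> k" "k < ?f k" "?f k \<le> n"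
      by (rule smallest_eq_Max[OF br k'])
    show "?f k \<le> i"
    proof (rule ccontr)
      \<comment> \<open>Each of the two brackets would then cover the gap of the other, so they
        would coincide, against injectivity.\<close>
      assume "\<not> ?f k \<le> i"
      then have "smallest B i \<subseteq> smallest B k"
        using b k by (intro smallest_props[OF br i] smallest_props(1)[OF br k']) auto
      moreover have "smallest B k \<subseteq> smallest B i"
        using a k by (intro smallest_props[OF br k'] smallest_props(1)[OF br i]) auto
      ultimately have "i = k" using inj_onD[OF inj, of i k] i k' by auto
      with k show False by simp
    qed
  next
    assume "1 < a"
    then have k': "1 \<le> a - 1" "a - 1 < n" using a i by auto
    obtain b where b: "smallest B (a - 1) = {b..?f (a - 1)}" "1 \<le> b" "b \<le> a - 1"
      "a - 1 < ?f (a - 1)" "?f (a - 1) \<le> n"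
      by (rule smallest_eq_Max[OF br k'])
    have mem: "a - 1 \<in> smallest B (a - 1)" "a \<in> smallest B (a - 1)"
      using smallest_props(2,3)[OF br k'] \<open>1 < a\<close> by auto
    have "a - 1 \<notin> smallest B i" "a \<in> smallest B i" using a \<open>1 < a\<close> by auto
    \<comment> \<open>Both brackets contain \<open>a\<close>, and \<open>a - 1\<close> rules out the
      other inclusion.\<close>
    then have "smallest B i \<subseteq> smallest B (a - 1)"
      using mem bracketingD(3)[OF br smallest_props(1)[OF br i] smallest_props(1)[OF br k']] by blast
    then have "?f i \<le> ?f (a - 1)" using a b by auto
    then show "i < ?f (a - 1)" using a by simp
  qed (use a in auto)
  then show ?thesis using a by (simp add: cluster_def)
qed

section \<open>The bijection\<close>

lemma bij_betw_clusters:
  assumes n: "2 \<le> n"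
  shows "bij_betw (\<lambda>f. cluster f ` {1..n-1}) (noncrossing n) (complete_bracketings n)"
proof (rule bij_betwI[where g = "right_ends n"])
  show "(\<lambda>f. cluster f ` {1..n-1}) \<in> noncrossing n \<rightarrow> complete_bracketings n"
    using clusters_complete_bracketing[OF n] by blast
  show "right_ends n \<in> complete_bracketings n \<rightarrow> noncrossing n"
    using right_ends_noncrossing by (auto simp: complete_bracketings_def)
next
  fix f assume f: "f \<in> noncrossing n"
  show "right_ends n (cluster f ` {1..n-1}) = f"
  proof (rule extensionalityI[where A = "{1..n-1}"])
    show "f \<in> extensional {1..n-1}" using f by (auto simp: noncrossing_def PiE_def)
    fix i assume "i \<in> {1..n-1}"
    then have i: "1 \<le> i" "i < n" by auto
    have "Max (cluster f i) = f i"
      using left_end_props(2)[OF i(1), of f] noncrossingD(1)[OF f i]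
      by (auto simp: cluster_def intro: Max_eqI)
    then show "right_ends n (cluster f ` {1..n-1}) i = f i"
      using smallest_clusters[OF f i] i by (auto simp: right_ends_def)
  qed (simp add: right_ends_def)
next
  fix B assume B: "B \<in> complete_bracketings n"
  have "cluster (right_ends n B) ` {1..n-1} = smallest B ` {1..n-1}"
    using cluster_right_ends[OF B] by (intro image_cong) auto
  also have "\<dots> = B" using B smallest_surj by (auto simp: complete_bracketings_def)
  finally show "cluster (right_ends n B) ` {1..n-1} = B" .
qed

theorem theorem4p4:
  fixes n :: nat and c :: "nat \<Rightarrow> real"
  assumes "n \<ge> 2"
    and "0 < c 1"
    and "strict_mono_on {1..n} c"
  shows "\<exists>\<phi>. bij_betw \<phi> (collision_patterns c n) (complete_bracketings n)"
proof -
  have "collision_patterns c n = noncrossing n"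
    using collision_pattern_noncrossing noncrossing_collision_pattern assms(3) by blast
  then show ?thesis using bij_betw_clusters[OF assms(1)] by auto
qed

end
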